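(* Let $(S,\wedge,0)$ be a meet-semilattice with least element $0$ satisfying the Ascending Chain Condition and let ${}^0$ be a unary operator on $S$, i.e. a map assigning to every $x\in S$ a non-empty subset $x^0$ of $S$. Then the following are equivalent: (i) $x^0=\operatorname{Max}\{y\in S\mid x\wedge y=0\}$ for all $x\in S$; (ii) the operator ${}^0$ satisfies the following conditions for all $x,y\in S$: (P1) $x^0$ is an antichain; (P2) $x\wedge 0^0\approx_1 x$; (P3) $x\wedge x^0\approx_1 0$; (P4) $x\wedge(x\wedge y)^0\approx_1 x\wedge y^0$.
   Context: The Ascending Chain Condition (ACC) means there is no infinite strictly ascending chain. Singletons are identified with their unique element (one writes $x$ for $\{x\}$). For a subset $A$ of a poset, $\operatorname{Max} A$ denotes the set of all maximal elements of $A$. For subsets $A,B$ of $S$: $A\leq_1 B$ means that for every $a\in A$ there exists some $b\in B$ with $a\leq b$; $A\approx_1 B$ means $A\leq_1 B$ and $B\leq_1 A$; and $A\wedge B:=\{a\wedge b\mid a\in A,\ b\in B\}$. When an element of $S$ occurs in one of these notations it stands for the corresponding singleton. In condition (P2), $0^0$ is the value of the given operator at the element $0$. *)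

theory Defs
  imports Main
begin

definition maximal_elements :: "'a::order set \<Rightarrow> 'a set" where
  "maximal_elements A = {m \<in> A. \<not> (\<exists>a\<in>A. m < a)}"

definition antichain :: "'a::order set \<Rightarrow> bool" where
  "antichain A \<longleftrightarrow> (\<forall>a\<in>A. \<forall>b\<in>A. a \<noteq> b \<longrightarrow> \<not> a \<le> b \<and> \<not> b \<le> a)"

definition le1 :: "'a::order set \<Rightarrow> 'a set \<Rightarrow> bool"  (infix "\<le>\<^sub>1" 50) where
  "A \<le>\<^sub>1 B \<longleftrightarrow> (\<forall>a\<in>A. \<exists>b\<in>B. a \<le> b)"

definition approx1 :: "'a::order set \<Rightarrow> 'a set \<Rightarrow> bool"  (infix "\<approx>\<^sub>1" 50) where
  "A \<approx>\<^sub>1 B \<longleftrightarrow> A \<le>\<^sub>1 B \<and> B \<le>\<^sub>1 A"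

definition set_inf :: "'a::semilattice_inf set \<Rightarrow> 'a set \<Rightarrow> 'a set"  (infixl "\<sqinter>\<^sub>S" 70) where
  "A \<sqinter>\<^sub>S B = {inf a b | a b. a \<in> A \<and> b \<in> B}"

end

theory Submission
  imports Defs
begin

text \<open>
  Write \<open>Ann x = {y. inf x y = bot}\<close>.  The theorem rests on the fact that \<open>Max A\<close>, once
  every element of \<open>A\<close> lies below a maximal one, is the only antichain that is contained in
  \<open>A\<close> and cofinal in \<open>A\<close> (\<open>antichain_cofinal_eq_maximal\<close>).  It therefore suffices to match
  the four conditions with these three properties for \<open>A = Ann x\<close>.

  If the operator is \<open>Max (Ann x)\<close>, the ascending chain condition gives cofinality
  (\<open>acc_imp_below_maximal\<close>).  Then (P2) is cofinality in \<open>Ann bot = UNIV\<close>, and (P4) holds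
  because an element \<open>a\<close> of \<open>Ann (inf x y)\<close> yields the element \<open>inf x a\<close> of \<open>Ann y\<close>, while
  \<open>Ann y\<close> is contained in \<open>Ann (inf x y)\<close>.

  Conversely, (P1) is the antichain property and (P3) is containment in \<open>Ann x\<close>.  Cofinality
  comes from (P2) and (P4): if \<open>inf z x = bot\<close>, then
  \<open>z \<approx>\<^sub>1 inf z (neg bot) = inf z (neg (inf z x)) \<approx>\<^sub>1 inf z (neg x)\<close>, so \<open>z\<close> lies below a member
  of \<open>neg x\<close>.
\<close>

lemma le1_trans: "A \<le>\<^sub>1 B \<Longrightarrow> B \<le>\<^sub>1 C \<Longrightarrow> A \<le>\<^sub>1 C"
  unfolding le1_def by (meson order_trans)

lemma singleton_inf_le1_iff:
  fixes x :: "'a::semilattice_inf"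
  shows "{x} \<sqinter>\<^sub>S B \<le>\<^sub>1 C \<longleftrightarrow> (\<forall>b\<in>B. \<exists>c\<in>C. inf x b \<le> c)"
  unfolding le1_def set_inf_def by auto

lemma le1_singleton_inf_iff:
  fixes x :: "'a::semilattice_inf"
  shows "A \<le>\<^sub>1 {x} \<sqinter>\<^sub>S B \<longleftrightarrow> (\<forall>a\<in>A. \<exists>b\<in>B. a \<le> inf x b)"
  unfolding le1_def set_inf_def by blast

text \<open>
  The chain condition makes \<open>>\<close> well-founded, so the members of \<open>A\<close> above \<open>a\<close> include one with
  no other of them above it; by transitivity nothing in all of \<open>A\<close> exceeds it.
\<close>

lemma acc_imp_below_maximal:
  fixes a :: "'a::order"
  assumes acc: "\<not> (\<exists>f :: nat \<Rightarrow> 'a. strict_mono f)" and "a \<in> A"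
  obtains m where "m \<in> maximal_elements A" and "a \<le> m"
proof -
  have "wf {(y, x :: 'a). x < y}"
    unfolding wf_iff_no_infinite_down_chain using acc by (auto simp: strict_mono_Suc_iff)
  moreover have "a \<in> {y \<in> A. a \<le> y}"
    using \<open>a \<in> A\<close> by simp
  ultimately obtain m where "m \<in> {y \<in> A. a \<le> y}"
    and "\<And>y. (y, m) \<in> {(y, x). x < y} \<Longrightarrow> y \<notin> {y \<in> A. a \<le> y}"
    by (rule wfE_min) blast
  then have "m \<in> maximal_elements A" and "a \<le> m"
    unfolding maximal_elements_def by (auto dest: order_trans[OF _ less_imp_le])
  then show thesis ..
qed

lemma antichain_maximal_elements: "antichain (maximal_elements A)"
  unfolding antichain_def maximal_elements_def by (auto simp: order.order_iff_strict)

text \<open>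
  A member of \<open>B\<close> is maximal because anything in \<open>A\<close> strictly above it would lie below another
  member of \<open>B\<close>; a maximal element of \<open>A\<close> must coincide with the member of \<open>B\<close> above it.
\<close>

lemma antichain_cofinal_eq_maximal:
  assumes "antichain B" and "B \<subseteq> A" and "A \<le>\<^sub>1 B"
  shows "B = maximal_elements A"
proof
  show "B \<subseteq> maximal_elements A"
  proof
    fix b assume "b \<in> B"
    have "\<not> b < a" if "a \<in> A" for a
    proof
      assume "b < a"
      obtain c where "c \<in> B" and "a \<le> c"
        using \<open>A \<le>\<^sub>1 B\<close> \<open>a \<in> A\<close> unfolding le1_def by blast
      with \<open>b < a\<close> have "b < c" by order
      with \<open>antichain B\<close> \<open>b \<in> B\<close> \<open>c \<in> B\<close> show False
        unfolding antichain_def by (auto simp: less_le)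
    qed
    with \<open>b \<in> B\<close> \<open>B \<subseteq> A\<close> show "b \<in> maximal_elements A"
      unfolding maximal_elements_def by blast
  qed
  show "maximal_elements A \<subseteq> B"
    using \<open>B \<subseteq> A\<close> \<open>A \<le>\<^sub>1 B\<close> unfolding maximal_elements_def le1_def
    by (smt (verit, best) mem_Collect_eq order.order_iff_strict subset_iff)
qed

theorem theorem3p6:
  fixes neg :: "'a::{semilattice_inf,order_bot} \<Rightarrow> 'a set"
  assumes acc: "\<not> (\<exists>f :: nat \<Rightarrow> 'a. strict_mono f)"
    and nonempty: "\<And>x. neg x \<noteq> {}"
  shows "(\<forall>x. neg x = maximal_elements {y. inf x y = bot}) \<longleftrightarrow>
    (\<forall>x y.
      antichain (neg x) \<and>
      {x} \<sqinter>\<^sub>S neg bot \<approx>\<^sub>1 {x} \<and>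
      {x} \<sqinter>\<^sub>S neg x \<approx>\<^sub>1 {bot} \<and>
      {x} \<sqinter>\<^sub>S neg (inf x y) \<approx>\<^sub>1 {x} \<sqinter>\<^sub>S neg y)"
    (is "?Max \<longleftrightarrow> ?P")
proof
  assume max: ?Max
  have annihilates: "inf x a = bot" if "a \<in> neg x" for x a
    using that max unfolding maximal_elements_def by auto
  have cofinal: "\<exists>b\<in>neg x. a \<le> b" if "inf x a = bot" for x a
  proof -
    obtain m where "m \<in> maximal_elements {y. inf x y = bot}" and "a \<le> m"
      using acc_imp_below_maximal[OF acc, of a "{y. inf x y = bot}"] \<open>inf x a = bot\<close> by blast
    then show ?thesis
      using max by blast
  qed
  show ?P
  proof (intro allI conjI)
    fix x y
    show "antichain (neg x)"
      using max antichain_maximal_elements by metis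
    show "{x} \<sqinter>\<^sub>S neg bot \<approx>\<^sub>1 {x}"
      unfolding approx1_def singleton_inf_le1_iff le1_singleton_inf_iff
      using cofinal[of bot x] by (simp add: inf_absorb1)
    show "{x} \<sqinter>\<^sub>S neg x \<approx>\<^sub>1 {bot}"
      unfolding approx1_def singleton_inf_le1_iff le1_singleton_inf_iff
      using annihilates nonempty[of x] by auto
    have "{x} \<sqinter>\<^sub>S neg (inf x y) \<le>\<^sub>1 {x} \<sqinter>\<^sub>S neg y"
      unfolding singleton_inf_le1_iff
    proof
      fix a assume "a \<in> neg (inf x y)"
      then have "inf y (inf x a) = bot"
        using annihilates[of a "inf x y"] by (simp add: ac_simps)
      then obtain b where "b \<in> neg y" and "inf x a \<le> b"
        using cofinal by blast
      then show "\<exists>c\<in>{x} \<sqinter>\<^sub>S neg y. inf x a \<le> c"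
        unfolding set_inf_def by auto
    qed
    moreover have "{x} \<sqinter>\<^sub>S neg y \<le>\<^sub>1 {x} \<sqinter>\<^sub>S neg (inf x y)"
      unfolding singleton_inf_le1_iff
    proof
      fix a assume "a \<in> neg y"
      then have "inf (inf x y) a = bot"
        using annihilates[of a y] by (simp add: inf_assoc inf_absorb2)
      then obtain b where "b \<in> neg (inf x y)" and "a \<le> b"
        using cofinal by blast
      then show "\<exists>c\<in>{x} \<sqinter>\<^sub>S neg (inf x y). inf x a \<le> c"
        unfolding set_inf_def by (blast intro: inf_mono order_refl)
    qed
    ultimately show "{x} \<sqinter>\<^sub>S neg (inf x y) \<approx>\<^sub>1 {x} \<sqinter>\<^sub>S neg y"
      unfolding approx1_def ..
  qed
next
  assume P: ?P
  show ?Max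
  proof
    fix x
    have "neg x \<subseteq> {y. inf x y = bot}"
      using P unfolding approx1_def singleton_inf_le1_iff by (auto simp: bot_unique)
    moreover have "{y. inf x y = bot} \<le>\<^sub>1 neg x"
      unfolding le1_def
    proof
      fix z assume "z \<in> {y. inf x y = bot}"
      then have "inf z x = bot"
        by (simp add: inf_commute)
      have "{z} \<le>\<^sub>1 {z} \<sqinter>\<^sub>S neg bot"
        using P unfolding approx1_def by blast
      moreover have "{z} \<sqinter>\<^sub>S neg bot \<le>\<^sub>1 {z} \<sqinter>\<^sub>S neg x"
        using P \<open>inf z x = bot\<close> unfolding approx1_def by metis
      ultimately have "{z} \<le>\<^sub>1 {z} \<sqinter>\<^sub>S neg x"
        by (rule le1_trans)
      then show "\<exists>b\<in>neg x. z \<le> b"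
        unfolding le1_singleton_inf_iff by auto
    qed
    ultimately show "neg x = maximal_elements {y. inf x y = bot}"
      using P antichain_cofinal_eq_maximal by blast
  qed
qed

end
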